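(* Let $(X,T)$ be a topological dynamical system. Then $(X,T)$ is strong mean sensitive if and only if it is strong sensitive in the mean.
   Context: A topological dynamical system $(X,T)$ consists of a nonempty compact metric space $X$ with metric $d$ and a continuous map $T:X\to X$. $S_n$ denotes the group of permutations of $\{1,\dots,n\}$. $(X,T)$ is strong mean sensitive if there exists $\delta>0$ such that for every $x\in X$ and every $\varepsilon>0$ there is $y\in X$ with $d(x,y)<\varepsilon$ and $\limsup_{n\to\infty}\inf_{\sigma\in S_n}\frac1n\sum_{k=1}^n d(T^kx,T^{\sigma(k)}y)>\delta$. $(X,T)$ is strong sensitive in the mean if there exists $\delta>0$ such that for every $x\in X$ and every $\varepsilon>0$ there exist an integer $n\ge1$ and $y\in X$ with $d(x,y)<\varepsilon$ and $\inf_{\sigma\in S_n}\frac1n\sum_{k=1}^n d(T^kx,T^{\sigma(k)}y)>\delta$. *)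

theory Defs
  imports "HOL-Analysis.Analysis" "HOL-Combinatorics.Permutations"
begin

(* The compact metric space is a subset X of a metric type, carrying the restricted metric. *)
locale topological_dynamical_system =
  fixes X :: "'a::metric_space set" and T :: "'a \<Rightarrow> 'a"
  assumes nonempty: "X \<noteq> {}"
    and compact: "compact X"
    and continuous: "continuous_on X T"
    and maps_to: "T ` X \<subseteq> X"

(* The infimum ranges over a finite nonempty set of reals, so it is a minimum.
   For n = 0 the value is 0. *)
definition perm_mean_dist :: "('a::metric_space \<Rightarrow> 'a) \<Rightarrow> nat \<Rightarrow> 'a \<Rightarrow> 'a \<Rightarrow> real" where
  "perm_mean_dist T n x y =
     (INF \<sigma>\<in>{\<sigma>. \<sigma> permutes {1..n}}.
        1 / real n * (\<Sum>k=1..n. dist ((T ^^ k) x) ((T ^^ \<sigma> k) y)))"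

(* The limit superior is taken in the extended reals, where it always exists. *)
definition strong_mean_sensitive :: "'a::metric_space set \<Rightarrow> ('a \<Rightarrow> 'a) \<Rightarrow> bool" where
  "strong_mean_sensitive X T \<longleftrightarrow>
     (\<exists>\<delta>::real. \<delta> > 0 \<and>
        (\<forall>x\<in>X. \<forall>\<epsilon>::real. \<epsilon> > 0 \<longrightarrow>
          (\<exists>y\<in>X. dist x y < \<epsilon> \<and>
             limsup (\<lambda>n. ereal (perm_mean_dist T n x y)) > ereal \<delta>)))"

definition strong_sensitive_in_the_mean :: "'a::metric_space set \<Rightarrow> ('a \<Rightarrow> 'a) \<Rightarrow> bool" where
  "strong_sensitive_in_the_mean X T \<longleftrightarrow>
     (\<exists>\<delta>::real. \<delta> > 0 \<and>
        (\<forall>x\<in>X. \<forall>\<epsilon>::real. \<epsilon> > 0 \<longrightarrow>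
          (\<exists>n::nat. n \<ge> 1 \<and> (\<exists>y\<in>X. dist x y < \<epsilon> \<and> perm_mean_dist T n x y > \<delta>))))"

end

theory Submission
  imports Defs
begin

text \<open>
  Write \<open>E\<^sub>n(x, y)\<close> for \<open>perm_mean_dist T n x y\<close>. A limit superior above \<open>\<delta>\<close> forces
  \<open>E\<^sub>n(x, y) > \<delta>\<close> for some \<open>n \<ge> 1\<close>, so strong mean sensitivity implies strong sensitivity in the
  mean with the same constant.

  For the converse, let \<open>\<delta>\<close> be a constant of strong sensitivity in the mean; then \<open>\<delta> / 4\<close> is a
  constant of strong mean sensitivity. Suppose it is not, so that for some \<open>x\<close> every point \<open>y\<close> of a
  ball around \<open>x\<close> satisfies \<open>limsup E\<^sub>n(x, y) \<le> \<delta> / 4\<close>. That ball is covered by the increasing sets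
  \<open>F\<^sub>N\<close> of those \<open>y\<close> with \<open>E\<^sub>n(x, y) \<le> \<delta> / 2\<close> for all \<open>n \<ge> N\<close>. Each \<open>F\<^sub>N\<close> is closed, so by the Baire
  category theorem in the compact space \<open>X\<close> some \<open>F\<^sub>N\<close> contains a ball around some \<open>z\<close>. As \<open>E\<^sub>n\<close>
  obeys the triangle inequality (\<open>perm_mean_dist_triangle\<close>), \<open>E\<^sub>n(z, y) \<le> \<delta>\<close> for all \<open>y\<close> in that ball
  and all \<open>n \<ge> N\<close>. For the finitely many \<open>n < N\<close> the same bound holds near \<open>z\<close> by continuity
  (\<open>perm_mean_dist_small_times\<close>). Hence \<open>E\<^sub>n(z, y) \<le> \<delta>\<close> for all \<open>n\<close> and all \<open>y\<close> near \<open>z\<close>, which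
  contradicts the choice of \<open>\<delta>\<close>.
\<close>

text \<open>The infimum over the finite set of permutations is attained. All later facts on
  \<open>perm_mean_dist\<close> use it only through this characterisation.\<close>

lemma perm_mean_dist_le_iff:
  "perm_mean_dist T n x y \<le> c \<longleftrightarrow>
     (\<exists>\<sigma>. \<sigma> permutes {1..n} \<and>
        1 / real n * (\<Sum>k=1..n. dist ((T ^^ k) x) ((T ^^ \<sigma> k) y)) \<le> c)"
proof -
  let ?P = "{\<sigma>. \<sigma> permutes {1..n}}"
  let ?m = "\<lambda>\<sigma>. 1 / real n * (\<Sum>k=1..n. dist ((T ^^ k) x) ((T ^^ \<sigma> k) y))"
  have fin: "finite (?m ` ?P)"
    by (intro finite_imageI finite_permutations) simp
  have ne: "?m ` ?P \<noteq> {}"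
    using permutes_id by blast
  have "perm_mean_dist T n x y = Min (?m ` ?P)"
    unfolding perm_mean_dist_def by (rule cInf_eq_Min[OF fin ne])
  then show ?thesis
    using Min_le_iff[OF fin ne] by auto
qed

lemma perm_mean_dist_triangle:
  "perm_mean_dist T n y z \<le> perm_mean_dist T n x y + perm_mean_dist T n x z"
proof -
  let ?d = "\<lambda>i u j v. dist ((T ^^ i) u) ((T ^^ j) v)"
  obtain \<sigma> where \<sigma>: "\<sigma> permutes {1..n}"
    and \<sigma>_le: "1 / real n * (\<Sum>k=1..n. ?d k x (\<sigma> k) y) \<le> perm_mean_dist T n x y"
    using perm_mean_dist_le_iff[of T n x y] by blast
  obtain \<tau> where \<tau>: "\<tau> permutes {1..n}"
    and \<tau>_le: "1 / real n * (\<Sum>k=1..n. ?d k x (\<tau> k) z) \<le> perm_mean_dist T n x z"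
    using perm_mean_dist_le_iff[of T n x z] by blast
  \<comment> \<open>Matching both orbits to that of \<open>x\<close> matches time \<open>\<sigma> k\<close> for \<open>y\<close> with time \<open>\<tau> k\<close> for \<open>z\<close>.\<close>
  have perm: "\<tau> \<circ> inv \<sigma> permutes {1..n}"
    using permutes_compose[OF permutes_inv[OF \<sigma>] \<tau>] .
  have "(\<Sum>k=1..n. ?d k y ((\<tau> \<circ> inv \<sigma>) k) z)
      = (\<Sum>k=1..n. ?d (\<sigma> k) y ((\<tau> \<circ> inv \<sigma>) (\<sigma> k)) z)"
    using sum.permute[OF \<sigma>, of "\<lambda>k. ?d k y ((\<tau> \<circ> inv \<sigma>) k) z"] by (simp add: o_def)
  also have "\<dots> = (\<Sum>k=1..n. ?d (\<sigma> k) y (\<tau> k) z)"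
    using permutes_inverses(2)[OF \<sigma>] by simp
  also have "\<dots> \<le> (\<Sum>k=1..n. ?d k x (\<sigma> k) y + ?d k x (\<tau> k) z)"
    by (intro sum_mono dist_triangle3)
  finally have "1 / real n * (\<Sum>k=1..n. ?d k y ((\<tau> \<circ> inv \<sigma>) k) z)
      \<le> 1 / real n * (\<Sum>k=1..n. ?d k x (\<sigma> k) y + ?d k x (\<tau> k) z)"
    by (intro mult_left_mono) auto
  also have "\<dots> \<le> perm_mean_dist T n x y + perm_mean_dist T n x z"
    using \<sigma>_le \<tau>_le by (simp add: sum.distrib add_divide_distrib)
  finally show ?thesis
    using perm unfolding perm_mean_dist_le_iff by blast
qed

context topological_dynamical_system
begin

lemma continuous_on_iterate: "continuous_on X (T ^^ k)"
proof -
  have "continuous_on X (T ^^ k) \<and> (T ^^ k) ` X \<subseteq> X"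
  proof (induction k)
    case 0
    then show ?case by simp
  next
    case (Suc k)
    then have "continuous_on X (\<lambda>x. T ((T ^^ k) x))"
      using continuous_on_compose2[OF continuous] by blast
    with Suc show ?case
      using maps_to by (auto simp: o_def)
  qed
  then show ?thesis ..
qed

lemma closedin_perm_mean_dist_le:
  "closedin (top_of_set X) {y \<in> X. perm_mean_dist T n x y \<le> c}"
proof -
  let ?m = "\<lambda>\<sigma> y. 1 / real n * (\<Sum>k=1..n. dist ((T ^^ k) x) ((T ^^ \<sigma> k) y))"
  have "continuous_on X (?m \<sigma>)" for \<sigma>
    by (intro continuous_intros continuous_on_iterate)
  then have "closedin (top_of_set X) (X \<inter> ?m \<sigma> -` {..c})" for \<sigma>
    by (intro continuous_closedin_preimage) auto
  then have "closedin (top_of_set X) (\<Union>\<sigma>\<in>{\<sigma>. \<sigma> permutes {1..n}}. X \<inter> ?m \<sigma> -` {..c})"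
    by (intro closedin_Union finite_imageI finite_permutations) auto
  moreover have "(\<Union>\<sigma>\<in>{\<sigma>. \<sigma> permutes {1..n}}. X \<inter> ?m \<sigma> -` {..c})
      = {y \<in> X. perm_mean_dist T n x y \<le> c}"
    unfolding perm_mean_dist_le_iff by auto
  ultimately show ?thesis by simp
qed

text \<open>Finitely many iterates of \<open>T\<close> are equicontinuous, and the identity permutation bounds the
  minimum.\<close>

lemma perm_mean_dist_small_times:
  assumes "z \<in> X" "\<delta> > 0"
  obtains \<eta> where "\<eta> > 0"
    "\<And>y n. \<lbrakk>y \<in> X; dist z y < \<eta>; n < N\<rbrakk> \<Longrightarrow> perm_mean_dist T n z y \<le> \<delta>"
proof -
  have "\<exists>\<eta>>0. \<forall>y\<in>X. dist z y < \<eta> \<longrightarrow> dist ((T ^^ k) z) ((T ^^ k) y) < \<delta>" for k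
    using continuous_on_iterate[of k] assms
    unfolding continuous_on_iff by (metis dist_commute)
  then obtain \<eta> where \<eta>: "\<And>k. \<eta> k > 0"
    "\<And>k y. \<lbrakk>y \<in> X; dist z y < \<eta> k\<rbrakk> \<Longrightarrow> dist ((T ^^ k) z) ((T ^^ k) y) < \<delta>"
    by metis
  show thesis
  proof (rule that[of "Min (\<eta> ` {..N})"])
    show "Min (\<eta> ` {..N}) > 0"
      using \<eta>(1) by (subst Min_gr_iff) auto
  next
    fix y n
    assume y: "y \<in> X" "dist z y < Min (\<eta> ` {..N})" and n: "n < N"
    have "dist ((T ^^ k) z) ((T ^^ k) y) \<le> \<delta>" if "k \<in> {1..n}" for k
    proof -
      have "dist z y < \<eta> k"
        using y(2) that n by (subst (asm) Min_gr_iff) auto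
      then show ?thesis
        using \<eta>(2) y(1) less_imp_le by blast
    qed
    then have "(\<Sum>k=1..n. dist ((T ^^ k) z) ((T ^^ id k) y)) \<le> real n * \<delta>"
      using sum_bounded_above[of "{1..n}" "\<lambda>k. dist ((T ^^ k) z) ((T ^^ k) y)" \<delta>] by simp
    then have "1 / real n * (\<Sum>k=1..n. dist ((T ^^ k) z) ((T ^^ id k) y)) \<le> \<delta>"
      using \<open>\<delta> > 0\<close> by (cases "n = 0") (auto simp: field_simps)
    then show "perm_mean_dist T n z y \<le> \<delta>"
      unfolding perm_mean_dist_le_iff using permutes_id by blast
  qed
qed

lemma strong_mean_sensitive_imp_strong_sensitive_in_the_mean:
  assumes "strong_mean_sensitive X T"
  shows "strong_sensitive_in_the_mean X T"
proof -
  have "\<exists>n\<ge>1. perm_mean_dist T n x y > \<delta>"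
    if "limsup (\<lambda>n. ereal (perm_mean_dist T n x y)) > ereal \<delta>" for x y \<delta>
  proof (rule ccontr)
    assume "\<not> ?thesis"
    then have "\<forall>\<^sub>F n in sequentially. ereal (perm_mean_dist T n x y) \<le> ereal \<delta>"
      unfolding eventually_sequentially by (intro exI[of _ 1]) (auto simp: not_less)
    then show False
      using Limsup_bounded that by (metis not_less)
  qed
  then show ?thesis
    using assms unfolding strong_mean_sensitive_def strong_sensitive_in_the_mean_def by meson
qed

text \<open>This is the Baire category step: a bound on the limit superior that is only pointwise in \<open>y\<close>
  becomes uniform on a ball, at the price of moving the centre and enlarging the bound.\<close>

lemma limsup_bound_imp_uniform_bound:
  assumes x: "x \<in> X" and "\<epsilon> > 0" and "a < c"
    and bound: "\<And>y. \<lbrakk>y \<in> X; dist x y < \<epsilon>\<rbrakk>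
      \<Longrightarrow> limsup (\<lambda>n. ereal (perm_mean_dist T n x y)) \<le> ereal a"
  obtains z r N where "z \<in> X" "r > 0"
    "\<And>y n. \<lbrakk>y \<in> X; dist z y < r; n \<ge> N\<rbrakk> \<Longrightarrow> perm_mean_dist T n x y \<le> c"
proof -
  define F where "F N = (\<Inter>n\<in>{N..}. {y \<in> X. perm_mean_dist T n x y \<le> c})" for N
  have F_closed: "closedin (top_of_set X) (F N)" for N
    unfolding F_def by (intro closedin_INT closedin_perm_mean_dist_le) auto
  have cover: "X \<inter> ball x \<epsilon> \<subseteq> \<Union> (range F)"
  proof
    fix y
    assume y: "y \<in> X \<inter> ball x \<epsilon>"
    then have "limsup (\<lambda>n. ereal (perm_mean_dist T n x y)) < ereal c"
      using bound[of y] \<open>a < c\<close> by (auto intro: le_less_trans)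
    then have "\<forall>\<^sub>F n in sequentially. ereal (perm_mean_dist T n x y) < ereal c"
      by (rule Limsup_lessD)
    then obtain N where "\<And>n. n \<ge> N \<Longrightarrow> perm_mean_dist T n x y < c"
      by (auto simp: eventually_sequentially)
    then have "y \<in> F N"
      using y by (auto simp: F_def intro: less_imp_le)
    then show "y \<in> \<Union> (range F)" by blast
  qed
  have "\<exists>N. (top_of_set X) interior_of (F N) \<noteq> {}"
  proof (rule ccontr)
    assume no_interior: "\<not> ?thesis"
    have "locally_compact_space (top_of_set X)" "Hausdorff_space (top_of_set X)"
      using compact
      by (simp_all add: compact_imp_locally_compact_space compact_space_subtopology
          Hausdorff_space_subtopology)
    then have "locally_compact_space (top_of_set X) \<and> regular_space (top_of_set X)"
      using locally_compact_Hausdorff_imp_regular_space by blast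
    then have "(top_of_set X) interior_of \<Union> (range F) = {}"
      using no_interior F_closed by (intro Baire_category_alt) auto
    moreover have "X \<inter> ball x \<epsilon> \<subseteq> (top_of_set X) interior_of \<Union> (range F)"
      by (intro interior_of_maximal cover openin_open_Int) simp
    ultimately show False
      using x \<open>\<epsilon> > 0\<close> by auto
  qed
  then obtain N z where z: "z \<in> (top_of_set X) interior_of (F N)"
    by blast
  have "openin (top_of_set X) ((top_of_set X) interior_of (F N))"
    by simp
  then obtain r where r: "r > 0" "\<And>y. \<lbrakk>y \<in> X; dist y z < r\<rbrakk> \<Longrightarrow> y \<in> F N" and "z \<in> X"
    using z interior_of_subset[of "top_of_set X" "F N"]
    unfolding openin_euclidean_subtopology_iff by blast
  show thesis
    using that[of z r N] r \<open>z \<in> X\<close> by (auto simp: F_def dist_commute)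
qed

lemma strong_sensitive_in_the_mean_imp_strong_mean_sensitive:
  assumes "strong_sensitive_in_the_mean X T"
  shows "strong_mean_sensitive X T"
proof -
  obtain \<delta> where "\<delta> > 0" and sens: "\<And>x \<epsilon>. \<lbrakk>x \<in> X; \<epsilon> > 0\<rbrakk>
      \<Longrightarrow> \<exists>n\<ge>1. \<exists>y\<in>X. dist x y < \<epsilon> \<and> perm_mean_dist T n x y > \<delta>"
    using assms unfolding strong_sensitive_in_the_mean_def by blast
  have "\<exists>y\<in>X. dist x y < \<epsilon> \<and> limsup (\<lambda>n. ereal (perm_mean_dist T n x y)) > ereal (\<delta> / 4)"
    if x: "x \<in> X" and "\<epsilon> > 0" for x \<epsilon>
  proof (rule ccontr)
    assume "\<not> ?thesis"
    then have "limsup (\<lambda>n. ereal (perm_mean_dist T n x y)) \<le> ereal (\<delta> / 4)"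
      if "y \<in> X" "dist x y < \<epsilon>" for y
      using that by (meson not_less)
    moreover have "\<delta> / 4 < \<delta> / 2"
      using \<open>\<delta> > 0\<close> by simp
    ultimately obtain z r N where z: "z \<in> X" and "r > 0"
      and large: "\<And>y n. \<lbrakk>y \<in> X; dist z y < r; n \<ge> N\<rbrakk> \<Longrightarrow> perm_mean_dist T n x y \<le> \<delta> / 2"
      using limsup_bound_imp_uniform_bound[OF x \<open>\<epsilon> > 0\<close>] by metis
    obtain \<eta> where "\<eta> > 0"
      and small: "\<And>y n. \<lbrakk>y \<in> X; dist z y < \<eta>; n < N\<rbrakk> \<Longrightarrow> perm_mean_dist T n z y \<le> \<delta>"
      using perm_mean_dist_small_times[OF z \<open>\<delta> > 0\<close>] by metis
    obtain n y where y: "y \<in> X" "dist z y < min r \<eta>" and gt: "perm_mean_dist T n z y > \<delta>"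
      using sens[OF z, of "min r \<eta>"] \<open>r > 0\<close> \<open>\<eta> > 0\<close> by auto
    have "perm_mean_dist T n z y \<le> \<delta>"
    proof (cases "n < N")
      case True
      then show ?thesis
        using small y by simp
    next
      case False
      then have "perm_mean_dist T n x z \<le> \<delta> / 2" "perm_mean_dist T n x y \<le> \<delta> / 2"
        using large z y \<open>r > 0\<close> by simp_all
      then show ?thesis
        using perm_mean_dist_triangle[of T n z y x] by linarith
    qed
    with gt show False by simp
  qed
  moreover have "\<delta> / 4 > 0"
    using \<open>\<delta> > 0\<close> by simp
  ultimately show ?thesis
    unfolding strong_mean_sensitive_def by blast
qed

end

theorem theorem2:
  fixes X :: "'a::metric_space set" and T :: "'a \<Rightarrow> 'a"
  assumes "topological_dynamical_system X T"
  shows "strong_mean_sensitive X T \<longleftrightarrow> strong_sensitive_in_the_mean X T"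
proof -
  interpret topological_dynamical_system X T by fact
  show ?thesis
    using strong_mean_sensitive_imp_strong_sensitive_in_the_mean
      strong_sensitive_in_the_mean_imp_strong_mean_sensitive by blast
qed

end
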